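(* For a positive integer $n$, an even integer $z$ and an integer $x$, let $$f_n(x\mid z)=\binom{n}{\frac{n-x}{2}}\binom{n}{\frac{n-z+x}{2}}\bigg/\binom{2n}{n-\frac z2},\qquad \psi_n(x\mid z)=2^{-n}\binom{n}{\frac{n-x+2\lceil z/4\rceil}{2}},$$ where a binomial coefficient $\binom{n}{j}$ is taken to be $0$ unless $j$ is an integer with $0\le j\le n$. Then for every constant $c>0$, $$\lim_{n\to\infty}\ \sup_{z}\ \left|\ \max_{x}\ \frac{f_n(x\mid z)}{\psi_n(x\mid z)}-\sqrt2\ \right|=0,$$ where the supremum is over even integers $z$ with $|z|\le c\sqrt n$ and the maximum is over integers $x$ with $|x|\le c\sqrt n$ and $x\equiv n \pmod 2$.
   Context: Here $f_n(\cdot\mid z)$ is the conditional probability mass function of $L$ given $S=z$ when $L$ and $S-L$ are independent $n$-step simple random walks (sums of $n$ i.i.d. uniform $\pm1$ variables), and $\psi_n(\cdot\mid z)$ is the probability mass function of $Y'+2\lceil z/4\rceil$ where $Y'$ is an $n$-step simple random walk. In words, the result states that the maximal ratio $f_n(x\mid z)/\psi_n(x\mid z)$ over $x=O(\sqrt n)$ converges to $\sqrt2$ as $n\to\infty$, for $z=O(\sqrt n)$. *)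

theory Defs
  imports Complex_Main "HOL-Number_Theory.Cong"
begin

text \<open>Binomial coefficient with a real lower argument: zero unless the argument is an
  integer between \<open>0\<close> and \<open>n\<close>. (The library's \<open>choose\<close> only takes natural numbers.)\<close>
definition binom :: "nat \<Rightarrow> real \<Rightarrow> real" where
  "binom n j = (if j \<in> \<int> \<and> 0 \<le> j \<and> j \<le> real n then real (n choose nat \<lfloor>j\<rfloor>) else 0)"

definition f_cond :: "nat \<Rightarrow> int \<Rightarrow> int \<Rightarrow> real" where
  "f_cond n x z = binom n ((real n - real_of_int x) / 2)
               * binom n ((real n - real_of_int z + real_of_int x) / 2)
             / binom (2 * n) (real n - real_of_int z / 2)"

definition psi_pmf :: "nat \<Rightarrow> int \<Rightarrow> int \<Rightarrow> real" where
  "psi_pmf n x z = (1 / 2 ^ n)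
     * binom n ((real n - real_of_int x + 2 * real_of_int \<lceil>real_of_int z / 4\<rceil>) / 2)"

text \<open>Both index sets below are finite. The set \<open>z_range c n\<close> always contains \<open>0\<close> for positive \<open>c\<close>;
  the set \<open>x_range c n\<close> may be empty, and \<open>psi_pmf\<close> may vanish on it, but only for finitely many \<open>n\<close>.\<close>
definition z_range :: "real \<Rightarrow> nat \<Rightarrow> int set" where
  "z_range c n = {z. even z \<and> \<bar>real_of_int z\<bar> \<le> c * sqrt (real n)}"

definition x_range :: "real \<Rightarrow> nat \<Rightarrow> int set" where
  "x_range c n = {x. \<bar>real_of_int x\<bar> \<le> c * sqrt (real n) \<and> [x = int n] (mod 2)}"

end

theory Submission
  imports Defs "HOL-Analysis.Summation_Tests" "HOL-Real_Asymp.Real_Asymp"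
begin

text \<open>
  Stirling's formula with an unspecified constant \<open>e\<^sup>L\<close> gives, uniformly for \<open>x = O(\<surd>n)\<close> with
  \<open>x \<equiv> n (mod 2)\<close>, that the binomial coefficient of \<open>n\<close> over \<open>(n - x)/2\<close> is asymptotic to
  \<open>2\<^bsup>n+1\<^esup> n\<^bsup>-1/2\<^esup> e\<^bsup>-L\<^esup> exp (- x\<^sup>2 / 2n)\<close>. Each of \<open>f_cond\<close> and \<open>psi_pmf\<close> has one more
  binomial coefficient in the numerator than in the denominator, so \<open>L\<close> cancels in their ratio. Writing \<open>w = 2 \<lceil>z/4\<rceil>\<close>, which
  differs from \<open>z/2\<close> by a bounded amount, the ratio is \<open>\<surd>2 exp (- (x - w)\<^sup>2 / 2n + o(1))\<close>. It is
  therefore at most \<open>\<surd>2 (1 + o(1))\<close>, and this is attained at the admissible \<open>x\<close> nearest to \<open>w\<close>.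
\<close>

section \<open>Stirling's formula up to its constant\<close>

text \<open>This is the logarithm of n! / (n^(n+1/2) e^(-n)).\<close>

definition stirling_error :: "nat \<Rightarrow> real" where
  "stirling_error n = ln (fact n) - (real n + 1/2) * ln (real n) + real n"

text \<open>Expanding ln (1 + 1/n) gives (n + 1/2) ln (1 + 1/n) = 1 + O(1/n^2), so the increments
  \<open>g n\<close> are O(1/n^2), hence summable, and their partial sums telescope.\<close>

lemma stirling_error_convergent: "convergent stirling_error"
proof -
  define g where "g n = stirling_error (Suc n) - stirling_error n" for n
  have g_eq: "g n = 1 - (real n + 1/2) * (ln (real n + 1) - ln (real n))" if "n > 0" for n
  proof -
    have "ln (fact (Suc n) :: real) = ln (real n + 1) + ln (fact n)"
      by (simp add: ln_mult add.commute)
    then show ?thesis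
      unfolding g_def stirling_error_def by (simp add: algebra_simps)
  qed
  have "(\<lambda>n. 1 - (real n + 1/2) * (ln (real n + 1) - ln (real n))) \<in> O(\<lambda>n. 1 / real n ^ 2)"
    by real_asymp
  also have "?this \<longleftrightarrow> g \<in> O(\<lambda>n. 1 / real n ^ 2)"
    by (intro landau_o.big.in_cong eventually_mono[OF eventually_gt_at_top[of 0]]) (simp add: g_eq)
  finally have bigo: "g \<in> O(\<lambda>n. 1 / real n ^ 2)" .
  have "summable (\<lambda>n. norm (1 / real n ^ 2))"
    using inverse_power_summable[of 2, where 'a = real] by (simp add: field_simps)
  then have "summable g"
    using bigo by (rule summable_comparison_test_bigo)
  then have "convergent (\<lambda>n. \<Sum>k<n. g k)"
    by (simp add: summable_iff_convergent)
  moreover have "(\<Sum>k<n. g k) = stirling_error n - stirling_error 0" for n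
    unfolding g_def by (rule sum_lessThan_telescope)
  ultimately have "convergent (\<lambda>n. (stirling_error n - stirling_error 0) + stirling_error 0)"
    by (intro convergent_add convergent_const) simp_all
  then show ?thesis by simp
qed

section \<open>Local limit theorem for binomial coefficients\<close>

text \<open>Substitute a = n(1-t)/2 and b = n(1+t)/2 in the factorial formula. The terms
  \<open>a ln a\<close> and \<open>b ln b\<close> produce the entropy term, the halves in the
  exponents a + 1/2 and b + 1/2 produce \<open>ln (1 - t\<^sup>2) / 2\<close>, and the linear terms
  cancel. The identity is exact, so all later errors come from taking limits.\<close>

lemma ln_binomial_eq:
  fixes a b :: nat
  defines "n \<equiv> a + b"
  defines "t \<equiv> (real b - real a) / real n"
  assumes "a > 0" "b > 0"
  shows "ln (real (n choose a)) =
    stirling_error n - stirling_error a - stirling_error b + (real n + 1) * ln 2 - ln (real n) / 2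
    - (real n / 2 * ((1 - t) * ln (1 - t) + (1 + t) * ln (1 + t)) + ln (1 - t\<^sup>2) / 2)"
proof -
  have n: "real n > 0" "real n = real a + real b" using assms by auto
  have t1: "1 - t = 2 * a / n" "1 + t = 2 * b / n"
    using n by (auto simp: t_def field_simps)
  have pos: "1 - t > 0" "1 + t > 0" using t1 n assms by auto
  have l1: "ln (1 - t) = ln 2 + ln a - ln n" "ln (1 + t) = ln 2 + ln b - ln n"
    unfolding t1 using n assms by (simp_all add: ln_mult ln_div)
  have "1 - t\<^sup>2 = (1 - t) * (1 + t)" by (simp add: power2_eq_square algebra_simps)
  then have l2: "ln (1 - t\<^sup>2) = ln (1 - t) + ln (1 + t)" using pos by (simp add: ln_mult)
  have "real (n choose a) = fact n / (fact a * fact b)"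
    using binomial_fact[of a n, where 'a = real] by (simp add: n_def)
  then have l3: "ln (real (n choose a)) = ln (fact n) - ln (fact a) - ln (fact b)"
    by (simp add: ln_mult ln_div)
  have e1: "real n / 2 * ((1 - t) * ln (1 - t) + (1 + t) * ln (1 + t))
     = real a * ln (1 - t) + real b * ln (1 + t)"
  proof -
    have "real n / 2 * (1 - t) = real a" "real n / 2 * (1 + t) = real b"
      unfolding t1 using n(1) by simp_all
    then show ?thesis by (simp only: distrib_left mult.assoc[symmetric])
  qed
  show ?thesis
    unfolding e1 unfolding l2 l1 l3 stirling_error_def n(2) by (simp add: algebra_simps diff_divide_distrib add_divide_distrib)
qed

text \<open>With t = x/n, the Stirling errors contribute L - L - L = -L in the limit, ln (1 - t^2)
  tends to 0, and the entropy term is t^2 + o(t^2). Since n t^2 is at most C^2, multiplying that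
  last error by n/2 leaves it uniformly small.\<close>

lemma ln_binom_local_limit:
  assumes lim: "stirling_error \<longlonglongrightarrow> L" and "C > 0" "\<epsilon> > 0"
  shows "\<forall>\<^sub>F n in sequentially. \<forall>x::int. \<bar>real_of_int x\<bar> \<le> C * sqrt (real n) \<longrightarrow> [x = int n] (mod 2) \<longrightarrow>
    binom n ((real n - real_of_int x) / 2) > 0 \<and>
    \<bar>ln (binom n ((real n - real_of_int x) / 2))
      - ((real n + 1) * ln 2 - ln (real n) / 2 - L - (real_of_int x)\<^sup>2 / (2 * real n))\<bar> < \<epsilon>"
proof -
  define g where "g t = (1 - t) * ln (1 - t) + (1 + t) * ln (1 + t)" for t :: real
  \<comment> \<open>Chosen so that (n/2) \<eta> t^2 \<le> \<eta> C^2 / 2 = \<epsilon>/8. Together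
    with \<epsilon>/4 for the logarithm and three Stirling errors of \<epsilon>/12, the total stays
    below \<epsilon>.\<close>
  define \<eta> where "\<eta> = \<epsilon> / (4 * C\<^sup>2)"
  have "\<eta> > 0" using assms by (simp add: \<eta>_def)
  have "((\<lambda>t. (g t - t\<^sup>2) / t\<^sup>2) \<longlongrightarrow> 0) (at 0)"
    unfolding g_def by real_asymp
  then have "\<forall>\<^sub>F t in at 0. \<bar>(g t - t\<^sup>2) / t\<^sup>2\<bar> < \<eta>"
    using \<open>\<eta> > 0\<close> by (auto simp: tendsto_iff dist_real_def)
  then obtain d1 where d1: "d1 > 0" "\<And>t. t \<noteq> 0 \<Longrightarrow> \<bar>t\<bar> < d1 \<Longrightarrow> \<bar>(g t - t\<^sup>2) / t\<^sup>2\<bar> < \<eta>"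
    by (auto simp: eventually_at dist_real_def)
  have g_bound: "\<bar>g t - t\<^sup>2\<bar> \<le> \<eta> * t\<^sup>2" if "\<bar>t\<bar> < d1" for t
    using d1(2)[of t] that by (cases "t = 0") (auto simp: g_def abs_divide field_simps)
  have "((\<lambda>t::real. ln (1 - t\<^sup>2) / 2) \<longlongrightarrow> ln (1 - 0\<^sup>2) / 2) (at 0)"
    by (intro tendsto_intros) auto
  then have "\<forall>\<^sub>F t in at (0::real). \<bar>ln (1 - t\<^sup>2) / 2\<bar> < \<epsilon> / 4"
    using \<open>\<epsilon> > 0\<close> by (auto simp: tendsto_iff dist_real_def mult.commute dest!: spec[of _ "\<epsilon> / 4"])
  then obtain d2 where d2: "d2 > 0" "\<And>t. t \<noteq> 0 \<Longrightarrow> \<bar>t\<bar> < d2 \<Longrightarrow> \<bar>ln (1 - t\<^sup>2) / 2\<bar> < \<epsilon> / 4"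
    by (auto simp: eventually_at dist_real_def)
  have ln_bound: "\<bar>ln (1 - t\<^sup>2) / 2\<bar> < \<epsilon> / 4" if "\<bar>t\<bar> < d2" for t
    using d2(2)[of t] that \<open>\<epsilon> > 0\<close> by (cases "t = 0") auto
  obtain N where N: "\<And>k. k \<ge> N \<Longrightarrow> \<bar>stirling_error k - L\<bar> < \<epsilon> / 12"
    using lim \<open>\<epsilon> > 0\<close> by (force simp: lim_sequentially dist_real_def dest!: spec[of _ "\<epsilon> / 12"])
  define d where "d = min (1/2) (min d1 d2)"
  have "d > 0" using d1 d2 by (simp add: d_def)
  have "(\<lambda>n. C * sqrt (real n) / real n) \<longlonglongrightarrow> 0"
    by real_asymp
  then have "\<forall>\<^sub>F n in sequentially. C * sqrt (real n) / real n < d"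
    using \<open>d > 0\<close> by (rule order_tendstoD)
  \<comment> \<open>The bound 1/2 in \<open>d\<close> gives |x| \<le> n/2, so a and b are at least
    n/4 \<ge> N + 1: both are positive and in the range where the Stirling error is near L.\<close>
  moreover have "\<forall>\<^sub>F n in sequentially. n \<ge> 4 * N + 4"
    by (rule eventually_ge_at_top)
  ultimately show ?thesis
  proof eventually_elim
    case (elim n)
    show ?case
    proof (intro allI impI)
      fix x :: int
      assume x: "\<bar>real_of_int x\<bar> \<le> C * sqrt (real n)" and par: "[x = int n] (mod 2)"
      define t where "t = real_of_int x / real n"
      have n: "real n > 0" "real n \<ge> 4 * real N + 4" using elim by linarith+
      have "\<bar>t\<bar> \<le> C * sqrt (real n) / real n"
        unfolding t_def abs_divide using x n by (simp add: divide_right_mono)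
      then have "\<bar>t\<bar> < d" using elim(1) by linarith
      then have t: "\<bar>t\<bar> < 1/2" "\<bar>t\<bar> < d1" "\<bar>t\<bar> < d2" by (auto simp: d_def)
      have "x\<^sup>2 \<le> (C * sqrt (real n))\<^sup>2"
        using power_mono[OF x, of 2] by simp
      then have nt: "real n * t\<^sup>2 \<le> C\<^sup>2"
        using n by (simp add: t_def power_mult_distrib power2_eq_square field_simps)
      have xt: "real_of_int x = t * real n" using n by (simp add: t_def)
      have "\<bar>real_of_int x\<bar> = \<bar>t\<bar> * real n" using xt by (simp add: abs_mult)
      also have "\<dots> \<le> 1/2 * real n" using t n by (intro mult_right_mono) auto
      finally have xn: "\<bar>real_of_int x\<bar> \<le> real n / 2" by simp
      have "even (int n - x)" "even (int n + x)"
        using par by (auto simp: cong_iff_dvd_diff)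
      then obtain p q where pq: "int n - x = 2 * p" "int n + x = 2 * q" unfolding dvd_def by blast
      define a b where "a = nat p" "b = nat q"
      have rpq: "real n - real_of_int x = 2 * real_of_int p" "real n + real_of_int x = 2 * real_of_int q"
        using pq by (metis of_int_diff of_int_add of_int_mult of_int_numeral of_int_of_nat_eq)+
      have ppos: "p > 0" "q > 0" using rpq xn n by linarith+
      have ab: "real n - real_of_int x = 2 * real a" "real n + real_of_int x = 2 * real b"
        "a > 0" "b > 0"
        using rpq ppos by (auto simp: a_b_def)
      have n_eq: "n = a + b" using ab(1,2) by linarith
      have ge: "a \<ge> N" "b \<ge> N" "n \<ge> N" using ab xn n by linarith+
      have bin: "binom n ((real n - real_of_int x) / 2) = real (n choose a)"
        unfolding binom_def ab(1) by (simp add: n_eq)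
      have tab: "(real b - real a) / real n = t"
        unfolding t_def using ab n_eq by (simp add: field_simps)
      have sq: "(real_of_int x)\<^sup>2 / (2 * real n) = real n / 2 * t\<^sup>2"
        using n by (simp add: t_def power2_eq_square field_simps)
      have ln_eq: "ln (real (n choose a)) =
          stirling_error n - stirling_error a - stirling_error b + (real n + 1) * ln 2 - ln (real n) / 2
          - (real n / 2 * g t + ln (1 - t\<^sup>2) / 2)"
        using ln_binomial_eq[of a b, OF ab(3,4)] unfolding n_eq[symmetric] tab g_def .
      have "\<bar>real n / 2 * g t - real n / 2 * t\<^sup>2\<bar> = real n / 2 * \<bar>g t - t\<^sup>2\<bar>"
        using n(1) by (simp only: right_diff_distrib[symmetric] abs_mult)
      also have "\<dots> \<le> real n / 2 * (\<eta> * t\<^sup>2)"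
        using g_bound[OF t(2)] n by (intro mult_left_mono) auto
      also have "\<dots> = \<eta> / 2 * (real n * t\<^sup>2)" by simp
      also have "\<dots> \<le> \<eta> / 2 * C\<^sup>2" using nt \<open>\<eta> > 0\<close> by (intro mult_left_mono) auto
      also have "\<dots> = \<epsilon> / 8" using \<open>C > 0\<close> by (simp add: \<eta>_def field_simps)
      finally have gb: "\<bar>real n / 2 * g t - real n / 2 * t\<^sup>2\<bar> \<le> \<epsilon> / 8" .
      have "\<bar>ln (real (n choose a))
          - ((real n + 1) * ln 2 - ln (real n) / 2 - L - real n / 2 * t\<^sup>2)\<bar> < \<epsilon>"
        unfolding ln_eq using gb ln_bound[OF t(3)] N[OF ge(1)] N[OF ge(2)] N[OF ge(3)] \<open>\<epsilon> > 0\<close>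
        by linarith
      moreover have "real (n choose a) > 0" by (simp add: n_eq)
      ultimately show "binom n ((real n - real_of_int x) / 2) > 0 \<and>
        \<bar>ln (binom n ((real n - real_of_int x) / 2))
          - ((real n + 1) * ln 2 - ln (real n) / 2 - L - (real_of_int x)\<^sup>2 / (2 * real n))\<bar> < \<epsilon>"
        unfolding bin sq by blast
    qed
  qed
qed

section \<open>Uniform asymptotics of the ratio\<close>

text \<open>Apply the local limit to all four binomial coefficients. The one in the denominator of
  \<open>f_cond\<close> has upper index 2n, and its term -ln (2n)/2 is what leaves ln 2 / 2.\<close>

lemma ln_ratio_uniform:
  assumes "c > 0" "\<epsilon> > 0"
  shows "\<forall>\<^sub>F n in sequentially. \<forall>z \<in> z_range c n. \<forall>x \<in> x_range c n.
    f_cond n x z / psi_pmf n x z > 0 \<and>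
    \<bar>ln (f_cond n x z / psi_pmf n x z)
      - (ln 2 / 2 - (real_of_int x - 2 * real_of_int \<lceil>real_of_int z / 4\<rceil>)\<^sup>2 / (2 * real n))\<bar> < \<epsilon>"
proof -
  obtain L where L: "stirling_error \<longlonglongrightarrow> L"
    using stirling_error_convergent by (auto simp: convergent_def)
  \<comment> \<open>The radius is 2c because the estimate is also applied at z - x and x - w. The
    share \<epsilon>/5 serves four binomial coefficients and the error of replacing z/2 by
    w.\<close>
  define P where "P n \<longleftrightarrow> (\<forall>x::int. \<bar>real_of_int x\<bar> \<le> 2 * c * sqrt (real n) \<longrightarrow> [x = int n] (mod 2) \<longrightarrow>
    binom n ((real n - real_of_int x) / 2) > 0 \<and>
    \<bar>ln (binom n ((real n - real_of_int x) / 2))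
      - ((real n + 1) * ln 2 - ln (real n) / 2 - L - (real_of_int x)\<^sup>2 / (2 * real n))\<bar> < \<epsilon> / 5)" for n
  have P: "\<forall>\<^sub>F n in sequentially. P n"
    unfolding P_def using assms by (intro ln_binom_local_limit[OF L]) auto
  moreover have "filterlim (\<lambda>n::nat. 2 * n) sequentially sequentially"
    by (intro mult_nat_left_at_top) auto
  then have "\<forall>\<^sub>F n in sequentially. P (2 * n)"
    using P by (simp add: filterlim_iff)
  \<comment> \<open>This bounds |2ud + d^2| / n when |u| \<le> 2c sqrt n and 0 \<le> d \<le>
    2.\<close>
  moreover have "(\<lambda>n. (8 * c * sqrt (real n) + 4) / real n) \<longlonglongrightarrow> 0"
    by real_asymp
  then have "\<forall>\<^sub>F n in sequentially. (8 * c * sqrt (real n) + 4) / real n < \<epsilon> / 5"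
    using assms by (intro order_tendstoD(2)) auto
  \<comment> \<open>Ensures |w| \<le> |z|/2 + 2 \<le> c sqrt n.\<close>
  moreover have "\<forall>\<^sub>F n in sequentially. 2 \<le> c / 2 * sqrt (real n)"
    using assms by real_asymp
  moreover have "\<forall>\<^sub>F n in sequentially. n > (0::nat)"
    by (rule eventually_gt_at_top)
  ultimately show ?thesis
  proof eventually_elim
    case (elim n)
    show ?case
    proof (intro ballI)
      fix z x assume "z \<in> z_range c n" "x \<in> x_range c n"
      then have z: "even z" "\<bar>real_of_int z\<bar> \<le> c * sqrt (real n)"
        and x: "\<bar>real_of_int x\<bar> \<le> c * sqrt (real n)" "[x = int n] (mod 2)"
        by (auto simp: z_range_def x_range_def)
      have n: "real n > 0" using elim by simp
      define w where "w = 2 * \<lceil>real_of_int z / 4\<rceil>"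
      define d where "d = real_of_int w - real_of_int z / 2"
      define u where "u = real_of_int x - real_of_int w"
      have d: "0 \<le> d" "d \<le> 2" unfolding d_def w_def by (simp, linarith)+
      have wb: "\<bar>real_of_int w\<bar> \<le> c * sqrt (real n)"
        using d z(2) elim(4) unfolding d_def by (simp add: abs_if split: if_splits)
      have ub: "\<bar>u\<bar> \<le> 2 * c * sqrt (real n)" unfolding u_def using wb x(1) by linarith
      have c0: "0 \<le> c * sqrt (real n)" using assms by simp
      have "even (x - int n)" using x(2) by (simp add: cong_iff_dvd_diff)
      then have par: "[z - x = int n] (mod 2)" "[x - w = int n] (mod 2)" "[z = int (2 * n)] (mod 2)"
        using z(1) by (auto simp: cong_iff_dvd_diff w_def)
      let ?A = "binom n ((real n - real_of_int x) / 2)"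
      let ?B = "binom n ((real n - real_of_int z + real_of_int x) / 2)"
      let ?D = "binom (2 * n) (real n - real_of_int z / 2)"
      let ?E = "binom n ((real n - real_of_int x + 2 * real_of_int \<lceil>real_of_int z / 4\<rceil>) / 2)"
      have A: "?A > 0" "\<bar>ln ?A - ((real n + 1) * ln 2 - ln (real n) / 2 - L - (real_of_int x)\<^sup>2 / (2 * real n))\<bar> < \<epsilon> / 5"
        using elim(1)[unfolded P_def, rule_format, of x] x c0 by auto
      have B: "?B > 0" "\<bar>ln ?B - ((real n + 1) * ln 2 - ln (real n) / 2 - L - (real_of_int z - real_of_int x)\<^sup>2 / (2 * real n))\<bar> < \<epsilon> / 5"
        using elim(1)[unfolded P_def, rule_format, of "z - x"] par(1) x z
        by (auto simp: algebra_simps)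
      have E: "?E > 0" "\<bar>ln ?E - ((real n + 1) * ln 2 - ln (real n) / 2 - L - u\<^sup>2 / (2 * real n))\<bar> < \<epsilon> / 5"
        using elim(1)[unfolded P_def, rule_format, of "x - w"] par(2) ub
        by (auto simp: u_def w_def algebra_simps)
      have "c * sqrt (real n) \<le> 2 * c * sqrt (real (2 * n))"
        using assms by (intro mult_mono) auto
      then have zb: "\<bar>real_of_int z\<bar> \<le> 2 * c * sqrt (real (2 * n))" using z by linarith
      have half: "(real (2 * n) - real_of_int z) / 2 = real n - real_of_int z / 2"
        by (simp add: field_simps)
      have D: "?D > 0" "\<bar>ln ?D - ((2 * real n + 1) * ln 2 - (ln 2 + ln (real n)) / 2 - L - (real_of_int z)\<^sup>2 / (4 * real n))\<bar> < \<epsilon> / 5"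
        using elim(2)[unfolded P_def, rule_format, OF zb par(3)] n unfolding half by (auto simp: ln_mult)
      have ratio: "f_cond n x z / psi_pmf n x z = (?A * ?B / ?D) / ((1 / 2 ^ n) * ?E)"
        by (simp add: f_cond_def psi_pmf_def)
      have pos: "f_cond n x z / psi_pmf n x z > 0"
        unfolding ratio using A B D E by simp
      have ln_ratio: "ln (f_cond n x z / psi_pmf n x z) = ln ?A + ln ?B - ln ?D - ln ?E + real n * ln 2"
        unfolding ratio using A(1) B(1) D(1) E(1) by (simp add: ln_mult ln_div ln_realpow)
      \<comment> \<open>Here x^2 + (z-x)^2 - z^2/2 = 2 (x - z/2)^2 and x - z/2 = u + d. Thus
        \<open>f_cond\<close> contributes -(u+d)^2/n, and dividing by \<open>psi_pmf\<close> adds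
        back u^2/(2n).\<close>
      have exponent: "- ((real_of_int x)\<^sup>2 / (2 * real n)) - (real_of_int z - real_of_int x)\<^sup>2 / (2 * real n)
          + (real_of_int z)\<^sup>2 / (4 * real n) + u\<^sup>2 / (2 * real n)
        = - (u\<^sup>2 / (2 * real n)) - (2 * u * d + d\<^sup>2) / real n"
        unfolding u_def d_def using n by (simp add: power2_eq_square field_simps)
      have small: "\<bar>(2 * u * d + d\<^sup>2) / real n\<bar> < \<epsilon> / 5"
      proof -
        have "\<bar>2 * u * d\<bar> \<le> 2 * (2 * c * sqrt (real n)) * 2"
          unfolding abs_mult using ub d c0 by (intro mult_mono) auto
        moreover have "\<bar>d\<^sup>2\<bar> \<le> 4" using power_mono[of d 2 2] d by simp
        ultimately have "\<bar>2 * u * d + d\<^sup>2\<bar> \<le> 8 * c * sqrt (real n) + 4" by linarith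
        then have "\<bar>(2 * u * d + d\<^sup>2) / real n\<bar> \<le> (8 * c * sqrt (real n) + 4) / real n"
          unfolding abs_divide using n by (simp add: divide_right_mono)
        then show ?thesis using elim(3) by linarith
      qed
      have ln2: "(2 * real n + 1) * ln 2 = 2 * (real n * ln 2) + (ln 2 :: real)"
        "(real n + 1) * ln 2 = real n * ln 2 + (ln 2 :: real)"
        by (simp_all add: algebra_simps)
      \<comment> \<open>With K = n ln 2, k = ln 2 and l = ln n the claim is linear: K, L and l
        cancel, k/2 survives, and five errors below \<epsilon>/5 add up.\<close>
      have combine: "\<bar>lA + lB - lD - lE + K - (k / 2 - U)\<bar> < \<epsilon>"
        if "- X - Y + Z + U = - U - q" "\<bar>q\<bar> < \<epsilon> / 5" "\<bar>lA - (K + k - l / 2 - L - X)\<bar> < \<epsilon> / 5"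
          "\<bar>lB - (K + k - l / 2 - L - Y)\<bar> < \<epsilon> / 5" "\<bar>lE - (K + k - l / 2 - L - U)\<bar> < \<epsilon> / 5"
          "\<bar>lD - (2 * K + k - (k + l) / 2 - L - Z)\<bar> < \<epsilon> / 5"
        for X Y Z U q lA lB lD lE K k l :: real
        using that by argo
      have "\<bar>ln (f_cond n x z / psi_pmf n x z) - (ln 2 / 2 - u\<^sup>2 / (2 * real n))\<bar> < \<epsilon>"
        unfolding ln_ratio
        by (rule combine[OF exponent small A(2)[unfolded ln2] B(2)[unfolded ln2] E(2)[unfolded ln2]
              D(2)[unfolded ln2]])
      then show "f_cond n x z / psi_pmf n x z > 0 \<and>
        \<bar>ln (f_cond n x z / psi_pmf n x z)
        - (ln 2 / 2 - (real_of_int x - 2 * real_of_int \<lceil>real_of_int z / 4\<rceil>)\<^sup>2 / (2 * real n))\<bar> < \<epsilon>"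
        using pos by (simp add: u_def w_def)
    qed
  qed
qed

section \<open>Maximum over x and supremum over z\<close>

lemma finite_x_range: "finite (x_range c n)"
proof (rule finite_subset)
  show "x_range c n \<subseteq> {- \<lceil>c * sqrt (real n)\<rceil>..\<lceil>c * sqrt (real n)\<rceil>}"
    unfolding x_range_def by (auto simp: abs_le_iff) linarith+
qed simp

theorem theorem7:
  fixes c :: real
  assumes "c > 0"
  shows "(\<lambda>n. SUP z \<in> z_range c n. \<bar>(MAX x \<in> x_range c n. f_cond n x z / psi_pmf n x z) - sqrt 2\<bar>)
           \<longlonglongrightarrow> 0"
proof (rule LIMSEQ_I)
  fix r :: real assume "r > 0"
  \<comment> \<open>The upper bound loses a factor exp e. The lower bound loses exp (-2e): one e for
    the estimate, one for the parity shift of at most 1 away from w. Aiming at r/2 keeps the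
    supremum strictly below r.\<close>
  have "((\<lambda>e::real. sqrt 2 * exp e) \<longlongrightarrow> sqrt 2 * exp 0) (at_right 0)"
       "((\<lambda>e::real. sqrt 2 * exp (- 2 * e)) \<longlongrightarrow> sqrt 2 * exp (- 2 * 0)) (at_right 0)"
    by (intro tendsto_intros)+
  then have "\<forall>\<^sub>F e in at_right 0. sqrt 2 * exp e < sqrt 2 + r / 2"
       "\<forall>\<^sub>F e in at_right 0. sqrt 2 * exp (- 2 * e) > sqrt 2 - r / 2"
    using \<open>r > 0\<close> by (auto intro!: order_tendstoD)
  moreover have "\<forall>\<^sub>F e in at_right (0::real). e > 0"
    by (rule eventually_at_right_less)
  ultimately have "\<forall>\<^sub>F e in at_right (0::real). e > 0 \<and> sqrt 2 * exp e < sqrt 2 + r / 2 \<and> sqrt 2 * exp (- 2 * e) > sqrt 2 - r / 2"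
    by eventually_elim auto
  then obtain e :: real where e: "e > 0" "sqrt 2 * exp e < sqrt 2 + r / 2" "sqrt 2 * exp (- 2 * e) > sqrt 2 - r / 2"
    using eventually_happens[of _ "at_right (0::real)"] by (auto simp: trivial_limit_at_right_real)
  have sqrt2: "exp (ln 2 / 2 + y) = sqrt 2 * exp y" for y :: real
    by (simp add: exp_add powr_half_sqrt[symmetric] powr_def)
  \<comment> \<open>The slack 3 is 2 for |w - z/2| plus 1 for |x0 - w|; it places \<open>x0\<close>
    in \<open>x_range c n\<close>, which is therefore nonempty.\<close>
  have "\<forall>\<^sub>F n in sequentially. 3 \<le> c / 2 * sqrt (real n)"
    using assms by real_asymp
  moreover have "(\<lambda>n. 1 / (2 * real n)) \<longlonglongrightarrow> 0" by real_asymp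
  then have "\<forall>\<^sub>F n in sequentially. 1 / (2 * real n) < e"
    using e by (intro order_tendstoD(2)) auto
  moreover note ln_ratio_uniform[OF assms e(1)]
  ultimately have "\<forall>\<^sub>F n in sequentially. norm ((SUP z \<in> z_range c n.
      \<bar>(MAX x \<in> x_range c n. f_cond n x z / psi_pmf n x z) - sqrt 2\<bar>) - 0) < r"
  proof eventually_elim
    case (elim n)
    let ?R = "\<lambda>x z. f_cond n x z / psi_pmf n x z"
    let ?M = "\<lambda>z. MAX x \<in> x_range c n. ?R x z"
    have bound: "\<bar>?M z - sqrt 2\<bar> \<le> r / 2" if z: "z \<in> z_range c n" for z
    proof -
      define w where "w = 2 * \<lceil>real_of_int z / 4\<rceil>"
      \<comment> \<open>As w is even, the parity of n decides whether w itself is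
        admissible.\<close>
      define x0 where "x0 = (if even n then w else w + 1)"
      have zb: "\<bar>real_of_int z\<bar> \<le> c * sqrt (real n)" using z by (simp add: z_range_def)
      have "\<bar>real_of_int w - real_of_int z / 2\<bar> \<le> 2" unfolding w_def by simp linarith
      moreover have x0w: "\<bar>real_of_int x0 - real_of_int w\<bar> \<le> 1" by (simp add: x0_def)
      ultimately have "\<bar>real_of_int x0\<bar> \<le> c * sqrt (real n)" using zb elim(1) by linarith
      moreover have "[x0 = int n] (mod 2)" by (auto simp: x0_def w_def cong_iff_dvd_diff)
      ultimately have x0: "x0 \<in> x_range c n" by (simp add: x_range_def)
      have upper: "?R x z \<le> sqrt 2 + r / 2" if x: "x \<in> x_range c n" for x
      proof -
        have pos: "?R x z > 0" and "\<bar>ln (?R x z) - (ln 2 / 2 - (real_of_int x - w)\<^sup>2 / (2 * real n))\<bar> < e"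
          using elim(3) z x by (auto simp: w_def)
        moreover have "(real_of_int x - w)\<^sup>2 / (2 * real n) \<ge> 0" by simp
        ultimately have "ln (?R x z) \<le> ln 2 / 2 + e" by linarith
        then have "exp (ln (?R x z)) \<le> exp (ln 2 / 2 + e)" by simp
        then show ?thesis using pos e(2) unfolding sqrt2 by simp
      qed
      have lower: "?R x0 z \<ge> sqrt 2 - r / 2"
      proof -
        have pos: "?R x0 z > 0" and "\<bar>ln (?R x0 z) - (ln 2 / 2 - (real_of_int x0 - w)\<^sup>2 / (2 * real n))\<bar> < e"
          using elim(3) z x0 by (auto simp: w_def)
        moreover have "(real_of_int x0 - w)\<^sup>2 / (2 * real n) \<le> 1 / (2 * real n)"
          using x0w by (intro divide_right_mono) (auto simp: abs_square_le_1)
        ultimately have "ln (?R x0 z) \<ge> ln 2 / 2 + - 2 * e" using elim(2) by linarith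
        then have "exp (ln (?R x0 z)) \<ge> exp (ln 2 / 2 + - 2 * e)" by simp
        then show ?thesis using pos e(3) unfolding sqrt2 by simp
      qed
      have "?M z \<le> sqrt 2 + r / 2"
        using finite_x_range[of c n] x0 upper by (subst Max_le_iff) auto
      moreover have "?R x0 z \<le> ?M z"
        using finite_x_range[of c n] x0 by (intro Max_ge) auto
      ultimately show ?thesis using lower by linarith
    qed
    \<comment> \<open>The supremum needs a nonempty index set, and the term at z = 0 also shows that
      it is nonnegative.\<close>
    have z0: "0 \<in> z_range c n" using assms by (simp add: z_range_def)
    have "(SUP z \<in> z_range c n. \<bar>?M z - sqrt 2\<bar>) \<le> r / 2"
      using z0 bound by (intro cSUP_least) auto
    moreover have "0 \<le> \<bar>?M 0 - sqrt 2\<bar>" by simp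
    moreover have "\<bar>?M 0 - sqrt 2\<bar> \<le> (SUP z \<in> z_range c n. \<bar>?M z - sqrt 2\<bar>)"
      using z0 bound by (intro cSUP_upper bdd_aboveI2[where M = "r / 2"]) auto
    ultimately show ?case using \<open>r > 0\<close> by simp
  qed
  then show "\<exists>no. \<forall>n\<ge>no. norm ((SUP z \<in> z_range c n.
      \<bar>(MAX x \<in> x_range c n. f_cond n x z / psi_pmf n x z) - sqrt 2\<bar>) - 0) < r"
    by (simp add: eventually_sequentially)
qed

end
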